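(* For each fixed $x>0$, $V_m(x)$ is decreasing in $m$ for real $m>-1$. In particular, for all real $m>-1$ and $x>0$, $$V_{m+1}(x)<V_m(x)<\frac1x.$$
   Context: For real $m>-1$ and $x>0$, $V_m(x)=\frac{2e^{x^2}}{\Gamma(m+1)}\int_x^\infty (t^2-x^2)^m e^{-t^2}\,dt=\frac{1}{\Gamma(m+1)}\int_0^\infty \frac{u^m e^{-u}}{\sqrt{x^2+u}}\,du$. *)

theory Defs
  imports "HOL-Analysis.Analysis"
begin

(* Meaningful for m > -1 and x > 0. The integral is the Lebesgue integral over the open
   half-line, on which t\<^sup>2 - x\<^sup>2 > 0, so that powr is the genuine real power; for -1 < m < 0 the
   integrand has an integrable singularity at t = x. *)
definition V :: "real \<Rightarrow> real \<Rightarrow> real" where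
  "V m x = 2 * exp (x\<^sup>2) / Gamma (m + 1) *
     set_lebesgue_integral lborel {x<..} (\<lambda>t. (t\<^sup>2 - x\<^sup>2) powr m * exp (- t\<^sup>2))"

end

theory Submission
  imports Defs
begin

text \<open>
  Substituting \<open>u = t\<^sup>2 - x\<^sup>2\<close> in the Gamma integral shows that
  \<open>2 t (t\<^sup>2 - x\<^sup>2)\<^sup>m exp (-(t\<^sup>2 - x\<^sup>2)) / \<Gamma>(m + 1)\<close> is a probability density on
  \<open>{x<..}\<close>: it is the law of \<open>T = sqrt (x\<^sup>2 + U)\<close> for a variable \<open>U\<close> with the Gamma distribution of
  shape \<open>m + 1\<close>. The integrand of \<open>V m x\<close> differs from this density by the missing factor \<open>t\<close>, so \<open>V m x\<close>
  is the mean of \<open>1 / T\<close>. The upper bound \<open>1 / x\<close> is then immediate, because \<open>T > x\<close>.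

  For \<open>m < n\<close>, the quotient of the two densities is
  \<open>(t\<^sup>2 - x\<^sup>2)\<^bsup>n - m\<^esup> \<Gamma>(m + 1) / \<Gamma>(n + 1)\<close>, which increases with \<open>t\<close> and crosses the value 1 at exactly one
  point \<open>c\<close>. So the passage from \<open>m\<close> to \<open>n\<close> moves mass from the left of \<open>c\<close> to its right,
  and the mean of the strictly decreasing function \<open>1 / t\<close> drops. The lemma
  \<open>set_integral_less_single_crossing\<close> turns this picture into an inequality.
\<close>

section \<open>Comparing integrals of densities that cross once\<close>

text \<open>
  The exempt point \<open>c\<close> will be where two densities cross, so that their difference vanishes
  there; openness of \<open>A\<close> gives it positive measure, and hence a strict conclusion.
\<close>

lemma set_integral_pos_except_point:
  fixes f :: "real \<Rightarrow> real"
  assumes A: "open A" "A \<noteq> {}" and int: "set_integrable lborel A f"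
    and pos: "\<And>t. t \<in> A \<Longrightarrow> t \<noteq> c \<Longrightarrow> 0 < f t"
  shows "0 < set_lebesgue_integral lborel A f"
proof -
  let ?g = "\<lambda>t. indicator A t *\<^sub>R f t"
  have int': "integrable lborel ?g" using int by (simp add: set_integrable_def)
  have ne: "AE t in lborel. t \<noteq> c" by (rule AE_lborel_singleton)
  have nonneg: "AE t in lborel. 0 \<le> ?g t"
    using ne by eventually_elim (auto simp: indicator_def less_imp_le pos)
  have "integral\<^sup>L lborel ?g \<noteq> 0"
  proof
    assume "integral\<^sup>L lborel ?g = 0"
    hence "AE t in lborel. ?g t = 0"
      using integral_nonneg_eq_0_iff_AE[OF int' nonneg] by simp
    hence "AE t in lborel. t \<notin> A"
      using ne by eventually_elim (use pos in \<open>force simp: indicator_def split: if_splits\<close>)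
    hence "emeasure lborel A = 0"
      using A by (subst (asm) AE_iff_measurable[where N = A]) auto
    hence "negligible A"
      using A by (auto simp: negligible_iff_null_sets null_sets_def)
    thus False using A open_not_negligible by blast
  qed
  moreover have "integral\<^sup>L lborel ?g \<ge> 0" by (rule integral_nonneg_AE[OF nonneg])
  ultimately show ?thesis by (simp add: set_lebesgue_integral_def)
qed

text \<open>
  As \<open>p\<close> and \<open>q\<close> have the same mass, a constant \<open>k\<close> may be subtracted from \<open>f\<close> without changing the
  difference of the two integrals. If \<open>k\<close> is the value of \<open>f\<close> at the crossing point \<open>c\<close>, then
  \<open>k - f\<close> and \<open>q - p\<close> change sign together.
\<close>

lemma set_integral_less_single_crossing:
  fixes f p q :: "real \<Rightarrow> real"
  assumes A: "open A" "A \<noteq> {}"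
    and p: "set_integrable lborel A p" and q: "set_integrable lborel A q"
    and fp: "set_integrable lborel A (\<lambda>t. f t * p t)"
    and fq: "set_integrable lborel A (\<lambda>t. f t * q t)"
    and mass: "set_lebesgue_integral lborel A p = set_lebesgue_integral lborel A q"
    and cross: "\<And>t. t \<in> A \<Longrightarrow> t \<noteq> c \<Longrightarrow> 0 < (k - f t) * (q t - p t)"
  shows "set_lebesgue_integral lborel A (\<lambda>t. f t * q t)
           < set_lebesgue_integral lborel A (\<lambda>t. f t * p t)"
proof -
  have eq: "(\<lambda>t. (k - f t) * (q t - p t))
      = (\<lambda>t. (k * q t - k * p t) - (f t * q t - f t * p t))"
    by (auto simp: algebra_simps)
  have kp: "set_integrable lborel A (\<lambda>t. k * p t)"
    and kq: "set_integrable lborel A (\<lambda>t. k * q t)"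
    using p q by auto
  have "0 < set_lebesgue_integral lborel A (\<lambda>t. (k - f t) * (q t - p t))"
    by (rule set_integral_pos_except_point[OF A _ cross])
       (auto simp: eq intro!: set_integral_diff(1) kp kq fp fq)
  also have "\<dots> = k * (set_lebesgue_integral lborel A q - set_lebesgue_integral lborel A p)
      - (set_lebesgue_integral lborel A (\<lambda>t. f t * q t)
         - set_lebesgue_integral lborel A (\<lambda>t. f t * p t))"
    unfolding eq
    by (simp add: set_integral_diff kp kq fp fq right_diff_distrib)
  finally show ?thesis using mass by simp
qed

section \<open>The probability density behind V\<close>

definition sqrt_gamma_density :: "real \<Rightarrow> real \<Rightarrow> real \<Rightarrow> real" where
  "sqrt_gamma_density x m t =
     2 * t * ((t\<^sup>2 - x\<^sup>2) powr m * exp (- (t\<^sup>2 - x\<^sup>2))) / Gamma (m + 1)"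

lemma image_power2_diff_greaterThan:
  fixes x :: real
  assumes "x \<ge> 0"
  shows "(\<lambda>t. t\<^sup>2 - x\<^sup>2) ` {x<..} = {0<..}"
proof (intro equalityI subsetI)
  fix u assume "u \<in> (\<lambda>t. t\<^sup>2 - x\<^sup>2) ` {x<..}"
  thus "u \<in> {0<..}" using assms by (auto simp: power_strict_mono)
next
  fix u :: real assume u: "u \<in> {0<..}"
  have "sqrt (x\<^sup>2) < sqrt (x\<^sup>2 + u)" using u by (subst real_sqrt_less_iff) simp
  moreover have "u = (sqrt (x\<^sup>2 + u))\<^sup>2 - x\<^sup>2" using u by simp
  ultimately show "u \<in> (\<lambda>t. t\<^sup>2 - x\<^sup>2) ` {x<..}" using assms by auto
qed

text \<open>
  The substitution \<open>u = t\<^sup>2 - x\<^sup>2\<close> in the Gamma integral. For \<open>m < 0 < x\<close> the integrand is unbounded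
  near \<open>t = x\<close>; the change of variables for absolutely integrable functions on the open
  half-line treats this case like the others.
\<close>

lemma Gamma_integral_power2_diff:
  fixes x m :: real
  assumes x: "x \<ge> 0" and m: "m > -1"
  defines "h \<equiv> \<lambda>t. 2 * t * ((t\<^sup>2 - x\<^sup>2) powr m * exp (- (t\<^sup>2 - x\<^sup>2)))"
  shows "set_integrable lborel {x<..} h \<and> set_lebesgue_integral lborel {x<..} h = Gamma (m + 1)"
proof -
  let ?f = "\<lambda>u::real. u powr m * exp (- u)"
  let ?g = "\<lambda>t::real. t\<^sup>2 - x\<^sup>2"
  have "((\<lambda>u. u powr m / exp u) has_integral Gamma (m + 1)) {0..}"
    using Gamma_integral_real[of "m + 1"] m by simp
  hence "((\<lambda>u. if u \<in> {0<..} then u powr m / exp u else 0) has_integral Gamma (m + 1)) {0..}"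
    by (rule has_integral_spike[of "{0}", rotated 2]) auto
  hence hi: "(?f has_integral Gamma (m + 1)) {0<..}"
    by (subst (asm) has_integral_restrict) (auto simp: exp_minus field_simps)
  have f_abs: "?f absolutely_integrable_on {0<..}"
    by (rule nonnegative_absolutely_integrable_1) (use hi in auto)
  have img: "?g ` {x<..} = {0<..}" by (rule image_power2_diff_greaterThan[OF x])
  have inj: "inj_on ?g {x<..}"
    using x by (auto intro!: inj_onI simp: power2_eq_iff_nonneg)
  have eq: "\<bar>2 * t\<bar> * ?f (?g t) = h t" if "t \<in> {x<..}" for t
    using that x by (auto simp: h_def)
  have "(\<lambda>t. \<bar>2 * t\<bar> * ?f (?g t)) absolutely_integrable_on {x<..} \<and>
      integral {x<..} (\<lambda>t. \<bar>2 * t\<bar> * ?f (?g t)) = Gamma (m + 1)"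
    by (subst has_absolute_integral_change_of_variables_1')
       (use f_abs hi inj img in \<open>auto intro!: derivative_eq_intros\<close>)
  moreover have "(\<lambda>t. \<bar>2 * t\<bar> * ?f (?g t)) absolutely_integrable_on {x<..}
      \<longleftrightarrow> h absolutely_integrable_on {x<..}"
    by (rule set_integrable_cong[OF refl refl eq])
  moreover have "integral {x<..} (\<lambda>t. \<bar>2 * t\<bar> * ?f (?g t)) = integral {x<..} h"
    by (rule Henstock_Kurzweil_Integration.integral_cong[OF eq])
  ultimately have h: "h absolutely_integrable_on {x<..}" "integral {x<..} h = Gamma (m + 1)"
    by metis+
  have meas: "(\<lambda>t. indicator {x<..} t *\<^sub>R h t) \<in> borel_measurable lborel"
    unfolding h_def by measurable
  have int: "set_integrable lborel {x<..} h"
    using h(1) integrable_completion[OF meas] by (simp add: set_integrable_def)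
  thus ?thesis using set_borel_integral_eq_integral(2)[OF int] h(2) by simp
qed

lemma sqrt_gamma_density_integral:
  assumes "x \<ge> 0" "m > -1"
  shows "set_integrable lborel {x<..} (sqrt_gamma_density x m)"
    and "set_lebesgue_integral lborel {x<..} (sqrt_gamma_density x m) = 1"
proof -
  have "Gamma (m + 1) > 0" using assms by (intro Gamma_real_pos) simp
  with Gamma_integral_power2_diff[OF assms]
  show "set_integrable lborel {x<..} (sqrt_gamma_density x m)"
    and "set_lebesgue_integral lborel {x<..} (sqrt_gamma_density x m) = 1"
    by (auto simp: sqrt_gamma_density_def[abs_def])
qed

lemma sqrt_gamma_density_pos:
  assumes "x \<ge> 0" "m > -1" "t > x"
  shows "0 < sqrt_gamma_density x m t"
proof -
  have "x\<^sup>2 < t\<^sup>2" using assms by (simp add: power_strict_mono)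
  moreover have "Gamma (m + 1) > 0" using assms by (intro Gamma_real_pos) simp
  ultimately show ?thesis using assms by (simp add: sqrt_gamma_density_def)
qed

lemma set_integrable_inverse_sqrt_gamma_density:
  assumes x: "x > 0" and m: "m > -1"
  shows "set_integrable lborel {x<..} (\<lambda>t. 1 / t * sqrt_gamma_density x m t)"
proof (rule set_integrable_bound)
  show "set_integrable lborel {x<..} (\<lambda>t. 1 / x * sqrt_gamma_density x m t)"
    using sqrt_gamma_density_integral(1)[of x m] x m by (intro set_integrable_mult_right) auto
  show "set_borel_measurable lborel {x<..} (\<lambda>t. 1 / t * sqrt_gamma_density x m t)"
    unfolding set_borel_measurable_def sqrt_gamma_density_def by measurable
  show "AE t in lborel. t \<in> {x<..} \<longrightarrow> norm (1 / t * sqrt_gamma_density x m t)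
      \<le> norm (1 / x * sqrt_gamma_density x m t)"
    using x by (auto simp: abs_mult intro!: AE_I2 divide_left_mono frac_le)
qed

lemma V_eq_integral_sqrt_gamma_density:
  assumes x: "x > 0"
  shows "V m x = set_lebesgue_integral lborel {x<..} (\<lambda>t. 1 / t * sqrt_gamma_density x m t)"
proof -
  have "V m x = set_lebesgue_integral lborel {x<..}
      (\<lambda>t. (2 * exp (x\<^sup>2) / Gamma (m + 1)) * ((t\<^sup>2 - x\<^sup>2) powr m * exp (- t\<^sup>2)))"
    unfolding V_def by (rule set_integral_mult_right[symmetric])
  also have "\<dots> = set_lebesgue_integral lborel {x<..} (\<lambda>t. 1 / t * sqrt_gamma_density x m t)"
    using x by (intro set_lebesgue_integral_cong)
      (auto simp: sqrt_gamma_density_def exp_diff exp_minus field_simps)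
  finally show ?thesis .
qed

section \<open>Bound and monotonicity\<close>

lemma V_less_inverse:
  assumes x: "x > 0" and m: "m > -1"
  shows "V m x < 1 / x"
proof -
  let ?p = "sqrt_gamma_density x m"
  note p = sqrt_gamma_density_integral[of x m]
  note ip = set_integrable_inverse_sqrt_gamma_density[OF x m]
  have ixp: "set_integrable lborel {x<..} (\<lambda>t. 1 / x * ?p t)"
    using p(1) x m by (intro set_integrable_mult_right) auto
  have "0 < set_lebesgue_integral lborel {x<..} (\<lambda>t. 1 / x * ?p t - 1 / t * ?p t)"
  proof (rule set_integral_pos_except_point)
    fix t assume t: "t \<in> {x<..}"
    hence "0 < (1 / x - 1 / t) * ?p t"
      using x m by (intro mult_pos_pos sqrt_gamma_density_pos) (auto simp: field_simps)
    thus "0 < 1 / x * ?p t - 1 / t * ?p t" by (simp only: left_diff_distrib)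
  qed (use ip ixp in \<open>auto intro: set_integral_diff(1)\<close>)
  also have "\<dots> = 1 / x * set_lebesgue_integral lborel {x<..} ?p - V m x"
    unfolding V_eq_integral_sqrt_gamma_density[OF x] set_integral_diff(2)[OF ixp ip]
      set_integral_mult_right ..
  finally show ?thesis using p(2) x m by simp
qed

lemma sqrt_gamma_density_diff:
  assumes "x \<ge> 0" "t > x" "m > -1" "n > -1"
  shows "sqrt_gamma_density x n t - sqrt_gamma_density x m t =
    sqrt_gamma_density x m t * (Gamma (m + 1) / Gamma (n + 1) * (t\<^sup>2 - x\<^sup>2) powr (n - m) - 1)"
proof -
  have "x\<^sup>2 < t\<^sup>2" using assms by (simp add: power_strict_mono)
  moreover have "Gamma (m + 1) > 0" "Gamma (n + 1) > 0"
    using assms by (auto intro!: Gamma_real_pos)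
  ultimately show ?thesis
    by (simp add: sqrt_gamma_density_def powr_diff field_simps)
qed

lemma V_strict_antimono:
  assumes x: "x > 0" and m: "m > -1" and mn: "m < n"
  shows "V n x < V m x"
proof -
  have n: "n > -1" using m mn by simp
  have G: "Gamma (m + 1) > 0" "Gamma (n + 1) > 0"
    using m n by (auto intro!: Gamma_real_pos)
  define r where "r = Gamma (n + 1) / Gamma (m + 1)"
  have r: "r > 0" using G by (simp add: r_def)
  \<comment> \<open>The quotient of the two densities is \<open>(t\<^sup>2 - x\<^sup>2)\<^bsup>n - m\<^esup> / r\<close>; \<open>c\<close> solves \<open>(c\<^sup>2 - x\<^sup>2)\<^bsup>n - m\<^esup> = r\<close>.\<close>
  define c where "c = sqrt (x\<^sup>2 + r powr (1 / (n - m)))"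
  have c2: "c\<^sup>2 - x\<^sup>2 = r powr (1 / (n - m))" by (simp add: c_def)
  have cr: "(c\<^sup>2 - x\<^sup>2) powr (n - m) = r" using mn r by (simp add: c2 powr_powr)
  have c0: "c > 0" using x by (simp add: c_def add_pos_nonneg)
  have cx: "c\<^sup>2 > x\<^sup>2" using c2 r by (smt (verit) powr_gt_zero)
  show ?thesis
    unfolding V_eq_integral_sqrt_gamma_density[OF x]
  proof (rule set_integral_less_single_crossing[where c = c and k = "1 / c"])
    fix t assume t: "t \<in> {x<..}" "t \<noteq> c"
    have t0: "t > 0" and tx: "t\<^sup>2 > x\<^sup>2" using t x by (auto simp: power_strict_mono)
    let ?d = "(t\<^sup>2 - x\<^sup>2) powr (n - m)"
    have diff: "sqrt_gamma_density x n t - sqrt_gamma_density x m t =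
        sqrt_gamma_density x m t * (?d / r - 1)"
      using sqrt_gamma_density_diff[of x t m n] t x m n by (simp add: r_def)
    have p: "sqrt_gamma_density x m t > 0"
      using t x m by (intro sqrt_gamma_density_pos) auto
    have "0 < (1 / c - 1 / t) * (?d / r - 1)"
    proof (cases "t < c")
      case True
      hence "t\<^sup>2 < c\<^sup>2" using t0 by (simp add: power_strict_mono)
      hence "?d < (c\<^sup>2 - x\<^sup>2) powr (n - m)" using tx mn by (intro powr_less_mono2) auto
      hence "?d / r - 1 < 0" using r cr by simp
      moreover have "1 / c - 1 / t < 0" using True t0 c0 by (simp add: field_simps)
      ultimately show ?thesis by (rule mult_neg_neg[rotated])
    next
      case False
      hence ct: "c < t" using t by simp
      hence "c\<^sup>2 < t\<^sup>2" using c0 by (simp add: power_strict_mono)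
      hence "(c\<^sup>2 - x\<^sup>2) powr (n - m) < ?d" using cx mn by (intro powr_less_mono2) auto
      hence "?d / r - 1 > 0" using r cr by simp
      moreover have "1 / c - 1 / t > 0" using ct t0 c0 by (simp add: field_simps)
      ultimately show ?thesis by (rule mult_pos_pos[rotated])
    qed
    from mult_pos_pos[OF p this]
    show "0 < (1 / c - 1 / t) * (sqrt_gamma_density x n t - sqrt_gamma_density x m t)"
      unfolding diff by (simp only: mult_ac)
  qed (use x m n in \<open>auto simp: sqrt_gamma_density_integral
         intro: set_integrable_inverse_sqrt_gamma_density[simplified]\<close>)
qed

theorem mainTheorem6:
  shows "(\<forall>x::real. x > 0 \<longrightarrow> strict_antimono_on {-1<..} (\<lambda>m::real. V m x)) \<and>
         (\<forall>m x::real. m > -1 \<longrightarrow> x > 0 \<longrightarrow> V (m + 1) x < V m x \<and> V m x < 1 / x)"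
  by (auto simp: monotone_on_def V_strict_antimono V_less_inverse simp del: less_divide_eq_1)

end
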